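(* Consider the model of densities $p_\lambda=p_0+u\lambda$ with local deviation parameter $\lambda\in\Lambda=\mathcal{C}(K)$, tangent space $\mathcal{T}=\mathcal{C}(K)$, and parameter of interest $\beta_0=p_0(x)=\psi(0)$, where $\psi(\lambda)=p_0(x)+u(x)\lambda(x)$. Then the semiparametric Fisher information $\mathcal{I}$ for $\beta_0$ satisfies $\mathcal{I}>0$ if and only if $\mu(\{x\})>0$.
   Context: $\mathcal{X}$ is a locally compact Hausdorff space with its Borel $\sigma$-algebra, and $\mu$ is a $\sigma$-finite, locally finite measure on $\mathcal{X}$ (every point has a neighborhood of finite measure). $P_0$ is a probability measure with continuous density $p_0\ge0$ with respect to $\mu$, $\operatorname{supp}(P_0)=\{y\in\mathcal{X}:p_0(y)>0\}$, and $x\in\operatorname{supp}(P_0)$ is a fixed point. $C,K$ are compact neighborhoods of $x$, $U$ is an open set, and $u\colon\mathcal{X}\to[0,1]$ is a continuous function such that $x\in C\subseteq U\subseteq K\subseteq\operatorname{supp}(P_0)$, $u=1$ on $C$, and $u=0$ on $\mathcal{X}\setminus U$. $\mathcal{C}(K)$ is the space of continuous real functions on $K$ with the supremum norm $\|\cdot\|_\infty$. For $\lambda\in\mathcal{C}(K)$, the product $u\lambda$ is understood as $0$ outside $K$; likewise $u\alpha/p_0$ is understood as $0$ outside $K$. In this model the true parameter is $\lambda_0=0$; the score operator is $A\colon\mathcal{C}(K)\to L_2(P_0)$, $A\alpha=u\alpha/p_0$; and the gradient of $\psi$ at $0$ is $\dot\psi\colon\mathcal{C}(K)\to\mathbb{R}$,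 $\dot\psi\alpha=\alpha(x)$. $\|\cdot\|_2$ is the $L_2(P_0)$ norm. Semiparametric Fisher information: $\mathcal{I}=\inf_\alpha\|A\alpha\|_2^2/|\dot\psi\alpha|^2$, the infimum being over $\alpha\in\mathcal{T}$ with $\dot\psi\alpha\ne0$.
   Formalization: It is additionally assumed that μ is outer regular at x: μ({x}) is the infimum of μ(V) over open V containing x. Without this the claim fails for the Dieudonné measure on [0,ω₁] at x=ω₁; it is automatic if X is first countable or μ is Radon. *)

theory Defs
  imports "HOL-Probability.Probability_Measure"
begin

definition locally_finite_measure :: "'a::topological_space measure \<Rightarrow> bool" where
  "locally_finite_measure \<mu> \<longleftrightarrow> (\<forall>y. \<exists>V. open V \<and> y \<in> V \<and> emeasure \<mu> V < \<infinity>)"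

definition outer_regular_on :: "'a::topological_space measure \<Rightarrow> 'a set \<Rightarrow> bool" where
  "outer_regular_on \<mu> B \<longleftrightarrow> emeasure \<mu> B = (INF V \<in> {V. B \<subseteq> V \<and> open V}. emeasure \<mu> V)"

text \<open>
  Local finiteness and sigma-finiteness do not make a Borel measure on a locally compact Hausdorff
  space outer regular at points: the Dieudonne measure on \<open>[0, \<omega>\<^sub>1]\<close> is a probability measure with
  no mass at \<open>\<omega>\<^sub>1\<close>, yet every neighbourhood of \<open>\<omega>\<^sub>1\<close> has measure \<open>1\<close>. The two lemmas below show that
  outer regularity at points does hold if the space is first countable, or if \<open>\<mu>\<close> is Radon, in
  any of the usual senses.
\<close>
lemma outer_regular_on_singletonI:
  assumes "sets \<mu> = sets borel"
    and "\<And>e. e > 0 \<Longrightarrow> e < \<infinity> \<Longrightarrow> \<exists>V. open V \<and> x \<in> V \<and> emeasure \<mu> V \<le> emeasure \<mu> {x} + e"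
  shows "outer_regular_on \<mu> {x}"
  unfolding outer_regular_on_def
proof (rule antisym)
  show "emeasure \<mu> {x} \<le> (INF V\<in>{V. {x} \<subseteq> V \<and> open V}. emeasure \<mu> V)"
    using assms(1) by (intro INF_greatest emeasure_mono) auto
  show "(INF V\<in>{V. {x} \<subseteq> V \<and> open V}. emeasure \<mu> V) \<le> emeasure \<mu> {x}"
  proof (rule ennreal_le_epsilon)
    fix e :: real assume "e > 0"
    then obtain V where "open V" "x \<in> V" "emeasure \<mu> V \<le> emeasure \<mu> {x} + ennreal e"
      using assms(2)[of "ennreal e"] by auto
    then show "(INF V\<in>{V. {x} \<subseteq> V \<and> open V}. emeasure \<mu> V) \<le> emeasure \<mu> {x} + ennreal e"
      by (intro INF_lower2[of V]) auto
  qed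
qed

lemma outer_regular_on_singleton_first_countable:
  fixes \<mu> :: "'a::{first_countable_topology, t2_space} measure"
  assumes sets: "sets \<mu> = sets borel" and fin: "locally_finite_measure \<mu>"
  shows "outer_regular_on \<mu> {x}"
proof (rule outer_regular_on_singletonI[OF sets])
  fix e :: ennreal assume e: "e > 0" "e < \<infinity>"
  obtain V where V: "open V" "x \<in> V" "emeasure \<mu> V < \<infinity>"
    using fin unfolding locally_finite_measure_def by blast
  obtain A :: "nat \<Rightarrow> 'a set" where A: "\<And>i. open (A i)" "\<And>i. x \<in> A i"
    "\<And>S. open S \<Longrightarrow> x \<in> S \<Longrightarrow> eventually (\<lambda>i. A i \<subseteq> S) sequentially"
    by (rule countable_basis_at_decseq[of x]) blast
  define B where "B n = V \<inter> (\<Inter>i\<le>n. A i)" for n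
  have B: "open (B n)" "x \<in> B n" for n
    using V A by (auto simp: B_def)
  have dec: "decseq B"
    by (force simp: B_def decseq_def)
  have INT: "(\<Inter>n. B n) = {x}"
  proof (intro equalityI subsetI)
    fix y assume y: "y \<in> (\<Inter>n. B n)"
    show "y \<in> {x}"
    proof (rule ccontr)
      assume "y \<notin> {x}"
      then obtain S where "open S" "x \<in> S" "y \<notin> S"
        using t1_space[of x y] by auto
      then obtain i where "A i \<subseteq> S"
        using A(3)[of S] eventually_sequentially by auto
      then show False
        using y \<open>y \<notin> S\<close> by (auto simp: B_def)
    qed
  qed (use B in auto)
  have fB: "emeasure \<mu> (B n) \<noteq> \<infinity>" for n
  proof -
    have "emeasure \<mu> (B n) \<le> emeasure \<mu> V"
      using V sets by (intro emeasure_mono) (auto simp: B_def)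
    then show ?thesis
      using V(3) by (auto simp: top_unique)
  qed
  have "(\<lambda>n. emeasure \<mu> (B n)) \<longlonglongrightarrow> emeasure \<mu> (\<Inter>n. B n)"
    using B sets by (intro Lim_emeasure_decseq dec fB) auto
  moreover have "emeasure \<mu> {x} < emeasure \<mu> {x} + e"
  proof -
    have "emeasure \<mu> {x} \<le> emeasure \<mu> V"
      using V sets by (intro emeasure_mono) auto
    then show ?thesis
      using V(3) e by (cases "emeasure \<mu> {x}"; cases e) (auto simp: top_unique ennreal_plus[symmetric] ennreal_less_iff simp del: ennreal_plus)
  qed
  ultimately have "eventually (\<lambda>n. emeasure \<mu> (B n) < emeasure \<mu> {x} + e) sequentially"
    unfolding INT by (rule order_tendstoD(2))
  then obtain n where "emeasure \<mu> (B n) < emeasure \<mu> {x} + e"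
    by (auto simp: eventually_sequentially)
  with B show "\<exists>V. open V \<and> x \<in> V \<and> emeasure \<mu> V \<le> emeasure \<mu> {x} + e"
    using less_imp_le by blast
qed

lemma outer_regular_on_singleton_radon:
  fixes \<mu> :: "'a::t2_space measure"
  assumes sets: "sets \<mu> = sets borel" and fin: "locally_finite_measure \<mu>"
    and inner: "\<And>V. open V \<Longrightarrow> emeasure \<mu> V = (SUP L \<in> {L. L \<subseteq> V \<and> compact L}. emeasure \<mu> L)"
  shows "outer_regular_on \<mu> {x}"
proof (rule outer_regular_on_singletonI[OF sets])
  fix e :: ennreal assume e: "e > 0" "e < \<infinity>"
  obtain V where V: "open V" "x \<in> V" "emeasure \<mu> V < \<infinity>"
    using fin unfolding locally_finite_measure_def by blast
  let ?W = "V - {x}"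
  have W: "open ?W" using V by auto
  have fW: "emeasure \<mu> ?W < \<infinity>"
    using V sets by (intro le_less_trans[OF emeasure_mono[of ?W V]]) auto
  have "\<exists>L. L \<subseteq> ?W \<and> compact L \<and> emeasure \<mu> ?W \<le> emeasure \<mu> L + e"
  proof (cases "emeasure \<mu> ?W \<le> e")
    case True
    then show ?thesis by (intro exI[of _ "{}"]) auto
  next
    case False
    then have "emeasure \<mu> ?W - e < emeasure \<mu> ?W"
      using fW e by (intro ennreal_between) auto
    then obtain L where "L \<subseteq> ?W" "compact L" "emeasure \<mu> ?W - e < emeasure \<mu> L"
      unfolding inner[OF W] less_SUP_iff by auto
    then show ?thesis
      by (intro exI[of _ L]) (auto simp: ennreal_minus_le_iff add.commute dest!: less_imp_le)
  qed
  then obtain L where L: "L \<subseteq> ?W" "compact L" "emeasure \<mu> ?W \<le> emeasure \<mu> L + e"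
    by blast
  have cL: "closed L" using L compact_imp_closed by blast
  have fL: "emeasure \<mu> L \<noteq> \<infinity>"
    using emeasure_mono[of L ?W \<mu>] L fW W sets by (auto simp: top_unique)
  have "emeasure \<mu> (?W - L) = emeasure \<mu> ?W - emeasure \<mu> L"
    using L cL W fL sets by (intro emeasure_Diff) auto
  also have "\<dots> \<le> e"
    using L fL by (auto simp: ennreal_minus_le_iff)
  finally have small: "emeasure \<mu> (?W - L) \<le> e" .
  have "emeasure \<mu> (V - L) \<le> emeasure \<mu> ({x} \<union> (?W - L))"
    using V cL W sets by (intro emeasure_mono) auto
  also have "\<dots> \<le> emeasure \<mu> {x} + emeasure \<mu> (?W - L)"
    using cL W sets by (intro emeasure_subadditive) auto
  also have "\<dots> \<le> emeasure \<mu> {x} + e"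
    using small by (intro add_mono) auto
  finally show "\<exists>V. open V \<and> x \<in> V \<and> emeasure \<mu> V \<le> emeasure \<mu> {x} + e"
    using V cL L by (intro exI[of _ "V - L"]) auto
qed

definition compact_nhd :: "'a::topological_space \<Rightarrow> 'a set \<Rightarrow> bool" where
  "compact_nhd x S \<longleftrightarrow> compact S \<and> x \<in> interior S"

definition supp :: "('a \<Rightarrow> real) \<Rightarrow> 'a set" where
  "supp p = {y. p y > 0}"

text \<open>
  The elements of \<open>cont_fun K\<close> are functions on \<open>K\<close> alone; extensionality fixes the irrelevant
  value \<open>undefined\<close> off \<open>K\<close>, so that equality is equality on \<open>K\<close>.
\<close>
definition cont_fun :: "'a::topological_space set \<Rightarrow> ('a \<Rightarrow> real) set" where
  "cont_fun K = {\<alpha> \<in> extensional K. continuous_on K \<alpha>}"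

definition L2_space :: "'a measure \<Rightarrow> ('a \<Rightarrow> real) set" where
  "L2_space P = {f \<in> borel_measurable P. integrable P (\<lambda>y. (f y)\<^sup>2)}"

definition L2_norm :: "'a measure \<Rightarrow> ('a \<Rightarrow> real) \<Rightarrow> real" where
  "L2_norm P f = sqrt (\<integral>y. (f y)\<^sup>2 \<partial>P)"

text \<open>
  The infimum is taken in the extended reals, so that it is \<open>\<infinity>\<close> if \<open>D\<close> vanishes on \<open>T\<close>.
\<close>
definition semiparametric_information ::
  "'a measure \<Rightarrow> 'b set \<Rightarrow> ('b \<Rightarrow> 'a \<Rightarrow> real) \<Rightarrow> ('b \<Rightarrow> real) \<Rightarrow> ereal" where
  "semiparametric_information P T A D =
     (INF \<alpha> \<in> {\<alpha> \<in> T. D \<alpha> \<noteq> 0}. ereal ((L2_norm P (A \<alpha>))\<^sup>2 / \<bar>D \<alpha>\<bar>\<^sup>2))"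

definition local_density :: "('a \<Rightarrow> real) \<Rightarrow> ('a \<Rightarrow> real) \<Rightarrow> 'a set \<Rightarrow> ('a \<Rightarrow> real) \<Rightarrow> 'a \<Rightarrow> real" where
  "local_density p0 u K l y = p0 y + (if y \<in> K then u y * l y else 0)"

definition local_param :: "('a \<Rightarrow> real) \<Rightarrow> ('a \<Rightarrow> real) \<Rightarrow> 'a \<Rightarrow> ('a \<Rightarrow> real) \<Rightarrow> real" where
  "local_param p0 u x l = p0 x + u x * l x"

definition local_score :: "('a \<Rightarrow> real) \<Rightarrow> ('a \<Rightarrow> real) \<Rightarrow> 'a set \<Rightarrow> ('a \<Rightarrow> real) \<Rightarrow> 'a \<Rightarrow> real" where
  "local_score p0 u K \<alpha> y = (if y \<in> K then u y * \<alpha> y / p0 y else 0)"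

definition local_gradient :: "'a \<Rightarrow> ('a \<Rightarrow> real) \<Rightarrow> real" where
  "local_gradient x \<alpha> = \<alpha> x"

text \<open>
  The four lemmas below tie \<open>local_score\<close> and \<open>local_gradient\<close> to the model: along the path
  \<open>t \<mapsto> t \<alpha>\<close> through the true parameter \<open>0\<close>, they are the derivatives of the log density and of
  the parameter of interest.
\<close>
lemma local_param_eq_density:
  "x \<in> K \<Longrightarrow> local_param p0 u x l = local_density p0 u K l x"
  by (simp add: local_param_def local_density_def)

lemma local_model_at_zero:
  assumes "x \<in> K"
  shows "local_density p0 u K (\<lambda>y\<in>K. 0) = p0" and "local_param p0 u x (\<lambda>y\<in>K. 0) = p0 x"
  using assms by (auto simp: local_density_def local_param_def)

lemma local_score_is_score:
  assumes "p0 y > 0"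
  shows "((\<lambda>t. ln (local_density p0 u K (\<lambda>z\<in>K. t * \<alpha> z) y))
    has_real_derivative local_score p0 u K \<alpha> y) (at 0)"
  using assms unfolding local_density_def local_score_def
  by (cases "y \<in> K") (auto intro!: derivative_eq_intros simp: divide_inverse)

lemma local_gradient_is_gradient:
  assumes "x \<in> K" "u x = 1"
  shows "((\<lambda>t. local_param p0 u x (\<lambda>z\<in>K. t * \<alpha> z))
    has_real_derivative local_gradient x \<alpha>) (at 0)"
  using assms unfolding local_param_def local_gradient_def
  by (auto intro!: derivative_eq_intros)

text \<open>
  The integral in \<open>L2_norm\<close> is a genuine one for all scores.
\<close>
lemma local_score_in_L2:
  fixes \<mu> :: "'a::t2_space measure"
  assumes sets: "sets \<mu> = sets borel"
    and prob: "prob_space (density \<mu> (\<lambda>y. ennreal (p0 y)))"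
    and p0: "continuous_on UNIV p0" and u: "continuous_on UNIV u"
    and K: "compact K" "K \<subseteq> supp p0"
    and \<alpha>: "\<alpha> \<in> cont_fun K"
  shows "local_score p0 u K \<alpha> \<in> L2_space (density \<mu> (\<lambda>y. ennreal (p0 y)))"
proof -
  let ?P = "density \<mu> (\<lambda>y. ennreal (p0 y))"
  interpret prob_space ?P by (rule prob)
  have cont: "continuous_on K (\<lambda>y. u y * \<alpha> y / p0 y)"
    using assms(3-) unfolding cont_fun_def supp_def
    by (intro continuous_intros) (auto intro: continuous_on_subset)
  have "local_score p0 u K \<alpha> \<in> borel_measurable borel"
    unfolding local_score_def using K
    by (intro borel_measurable_continuous_on_if cont borel_closed compact_imp_closed) auto
  then have meas [measurable]: "local_score p0 u K \<alpha> \<in> borel_measurable ?P"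
    by (simp add: measurable_def sets sets_eq_imp_space_eq[OF sets])
  have "compact ((\<lambda>y. u y * \<alpha> y / p0 y) ` K)"
    using cont K(1) by (rule compact_continuous_image)
  then obtain B where B: "\<And>y. y \<in> K \<Longrightarrow> \<bar>u y * \<alpha> y / p0 y\<bar> \<le> B"
    by (fastforce dest!: compact_imp_bounded simp: bounded_iff)
  have bound: "(local_score p0 u K \<alpha> y)\<^sup>2 \<le> B\<^sup>2" for y
  proof (cases "y \<in> K")
    case True
    then show ?thesis
      using power_mono[OF B[OF True] abs_ge_zero, of 2, unfolded power2_abs] True
      by (simp only: local_score_def if_True)
  qed (simp add: local_score_def)
  have "integrable ?P (\<lambda>y. (local_score p0 u K \<alpha> y)\<^sup>2)"
    by (rule integrable_const_bound[where B = "B\<^sup>2"]) (use bound in auto)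
  with meas show ?thesis
    by (simp add: L2_space_def)
qed

end

(* If \<open>\<mu> {x} > 0\<close>, then \<open>\<parallel>A \<alpha>\<parallel>\<^sup>2\<close> is at least the contribution of the atom \<open>x\<close>, which is a fixed positive
   multiple of \<open>(\<alpha> x)\<^sup>2\<close>. If \<open>\<mu> {x} = 0\<close>, then outer regularity gives open neighbourhoods \<open>V\<close> of \<open>x\<close>
   with \<open>\<mu> V\<close> arbitrarily small, and a Urysohn function \<open>\<alpha>\<close> with \<open>\<alpha> x = 1\<close> supported in \<open>V\<close>
   has \<open>\<parallel>A \<alpha>\<parallel>\<^sup>2\<close> at most a constant multiple of \<open>\<mu> V\<close>. *)
theory Submission
  imports Defs
begin

text \<open>A compact Hausdorff space is normal, so Urysohn's lemma applies in the subspace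
  \<open>K\<close> to the disjoint closed sets \<open>K - V\<close> and \<open>{x}\<close>. Working
  inside \<open>K\<close> is enough, because the elements of \<open>cont_fun K\<close> live on
  \<open>K\<close> only.\<close>

lemma compact_bump_function:
  fixes K V :: "'a::t2_space set"
  assumes K: "compact K" "x \<in> K" and V: "open V" "x \<in> V"
  obtains \<alpha> where "\<alpha> \<in> cont_fun K" "\<alpha> x = 1" "\<And>y. y \<in> K \<Longrightarrow> 0 \<le> \<alpha> y \<and> \<alpha> y \<le> (1::real)"
    "\<And>y. y \<in> K \<Longrightarrow> y \<notin> V \<Longrightarrow> \<alpha> y = 0"
proof -
  have "compact_space (top_of_set K)"
    using K by (simp add: compact_space_subtopology)
  moreover have "Hausdorff_space (top_of_set K)"
    using hausdorff[where 'a='a]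
    by (intro Hausdorff_space_subtopology) (simp add: Hausdorff_space_def disjnt_def)
  ultimately have "normal_space (top_of_set K)"
    using compact_Hausdorff_or_regular_imp_normal_space by blast
  moreover have "closedin (top_of_set K) (K - V)"
    using V by (auto simp: closedin_closed intro!: exI[of _ "- V"])
  moreover have "closedin (top_of_set K) {x}"
    using K by (auto simp: closedin_closed intro!: exI[of _ "{x}"])
  moreover have "disjnt (K - V) {x}"
    using V by (simp add: disjnt_def)
  ultimately obtain f where f: "continuous_map (top_of_set K) (top_of_set {0..1::real}) f"
      "f ` (K - V) \<subseteq> {0}" "f ` {x} \<subseteq> {1}"
    by (rule Urysohn_lemma[where a = 0 and b = 1]) auto
  have "continuous_on K f" "f ` K \<subseteq> {0..1}"
    using f(1) by (auto simp: continuous_map_in_subtopology)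
  \<comment> \<open>Restriction leaves the values on \<open>K\<close> alone and supplies the
    extensionality that \<open>cont_fun K\<close> demands.\<close>
  then show ?thesis
    using f(2,3) K by (intro that[of "restrict f K"]) (auto simp: cont_fun_def)
qed

lemma L2_norm_power2: "(L2_norm P f)\<^sup>2 = (\<integral>y. (f y)\<^sup>2 \<partial>P)"
  by (simp add: L2_norm_def)

text \<open>A positive infimum of quotients amounts to one constant \<open>c\<close> that works for
  all directions. Clearing the denominator removes the side condition
  \<open>D \<alpha> \<noteq> 0\<close>, as the inequality is trivial where
  \<open>D \<alpha> = 0\<close>.\<close>

lemma semiparametric_information_pos_iff:
  assumes "\<exists>\<alpha>\<in>T. D \<alpha> \<noteq> 0"
  shows "0 < semiparametric_information P T A D \<longleftrightarrow>
    (\<exists>c>0. \<forall>\<alpha>\<in>T. c * (D \<alpha>)\<^sup>2 \<le> (L2_norm P (A \<alpha>))\<^sup>2)" (is "0 < ?I \<longleftrightarrow> ?R")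
proof
  assume I: "0 < ?I"
  \<comment> \<open>The infimum is an extended real, whereas the bound needs a real constant; any
    real strictly between 0 and \<open>?I\<close> will do.\<close>
  then obtain c where c: "0 < ereal c" "ereal c < ?I"
    using ereal_dense2 by blast
  have "c * (D \<alpha>)\<^sup>2 \<le> (L2_norm P (A \<alpha>))\<^sup>2" if "\<alpha> \<in> T" for \<alpha>
  proof (cases "D \<alpha> = 0")
    case False
    then have "?I \<le> ereal ((L2_norm P (A \<alpha>))\<^sup>2 / \<bar>D \<alpha>\<bar>\<^sup>2)"
      unfolding semiparametric_information_def using that by (intro INF_lower) auto
    with c(2) have "ereal c < ereal ((L2_norm P (A \<alpha>))\<^sup>2 / \<bar>D \<alpha>\<bar>\<^sup>2)"
      by (rule less_le_trans)
    with False show ?thesis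
      by (simp add: field_simps)
  qed simp
  with c(1) show ?R by auto
next
  assume ?R
  then obtain c where c: "c > 0" "\<And>\<alpha>. \<alpha> \<in> T \<Longrightarrow> c * (D \<alpha>)\<^sup>2 \<le> (L2_norm P (A \<alpha>))\<^sup>2"
    by blast
  have "ereal c \<le> ?I"
    unfolding semiparametric_information_def
    using c(2) by (intro INF_greatest) (auto simp: field_simps)
  with c(1) show "0 < ?I"
    by (metis ereal_less(2) less_le_trans)
qed

text \<open>At \<open>x\<close> the squared score equals \<open>(\<alpha> x / p0 x)^2\<close>,
  because \<open>u x = 1\<close>, and elsewhere it is nonnegative. The factor of
  \<open>(\<alpha> x)^2\<close> does not depend on \<open>\<alpha>\<close>, so it can serve as the
  uniform constant \<open>c\<close>.\<close>

lemma local_score_norm_ge_atom: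
  assumes P: "finite_measure P" "{x} \<in> sets P" "local_score p0 u K \<alpha> \<in> L2_space P"
    and x: "x \<in> K" "u x = 1"
  shows "measure P {x} / (p0 x)\<^sup>2 * (\<alpha> x)\<^sup>2 \<le> (L2_norm P (local_score p0 u K \<alpha>))\<^sup>2"
proof -
  interpret finite_measure P by (rule P)
  have "measure P {x} / (p0 x)\<^sup>2 * (\<alpha> x)\<^sup>2 = (\<integral>y. (\<alpha> x / p0 x)\<^sup>2 * indicator {x} y \<partial>P)"
    using P(2) sets.sets_into_space[OF P(2)] by (simp add: power_divide Int_absorb2)
  also have "\<dots> \<le> (\<integral>y. (local_score p0 u K \<alpha> y)\<^sup>2 \<partial>P)"
  proof (rule integral_mono)
    show "integrable P (\<lambda>y. (\<alpha> x / p0 x)\<^sup>2 * indicator {x} y)"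
      using P(2) by (intro integrable_mult_right integrable_real_indicator) (auto simp: emeasure_eq_measure)
  qed (use P(3) x in \<open>auto simp: L2_space_def local_score_def indicator_def\<close>)
  finally show ?thesis
    by (simp add: L2_norm_power2)
qed

text \<open>The score is at most \<open>1 / m\<close> in absolute value on \<open>V\<close> and
  vanishes off \<open>V\<close>, so its square is dominated by \<open>(1 / m)^2\<close> times the
  indicator of \<open>V\<close>.\<close>

lemma local_score_norm_le_support:
  assumes P: "finite_measure P" "V \<in> sets P" "local_score p0 u K \<alpha> \<in> L2_space P"
    and b: "0 < m" "\<And>y. y \<in> K \<Longrightarrow> y \<in> V \<Longrightarrow> m \<le> p0 y"
    and u: "\<And>y. \<bar>u y\<bar> \<le> 1"
    and \<alpha>: "\<And>y. y \<in> K \<Longrightarrow> \<bar>\<alpha> y\<bar> \<le> 1" "\<And>y. y \<in> K \<Longrightarrow> y \<notin> V \<Longrightarrow> \<alpha> y = 0"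
  shows "(L2_norm P (local_score p0 u K \<alpha>))\<^sup>2 \<le> measure P V / m\<^sup>2"
proof -
  interpret finite_measure P by (rule P)
  have *: "(local_score p0 u K \<alpha> y)\<^sup>2 \<le> (1 / m)\<^sup>2 * indicator V y" for y
  proof (cases "y \<in> K \<and> y \<in> V")
    case True
    have "\<bar>u y * \<alpha> y\<bar> \<le> 1 * 1"
      unfolding abs_mult using u[of y] \<alpha>(1) True by (intro mult_mono) auto
    then have "\<bar>u y * \<alpha> y\<bar> / \<bar>p0 y\<bar> \<le> 1 / m"
      using b(1) b(2)[of y] True by (intro frac_le) auto
    then have "\<bar>u y * \<alpha> y / p0 y\<bar>\<^sup>2 \<le> (1 / m)\<^sup>2"
      unfolding abs_divide by (intro power_mono) auto
    then show ?thesis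
      using True by (simp only: local_score_def if_True power2_abs indicator_simps mult_1_right)
  qed (use \<alpha>(2)[of y] in \<open>auto simp: local_score_def indicator_def\<close>)
  have "(\<integral>y. (local_score p0 u K \<alpha> y)\<^sup>2 \<partial>P) \<le> (\<integral>y. (1 / m)\<^sup>2 * indicator V y \<partial>P)"
  proof (rule integral_mono)
    show "integrable P (\<lambda>y. (1 / m)\<^sup>2 * indicator V y)"
      using P(2) by (intro integrable_mult_right integrable_real_indicator) (auto simp: emeasure_eq_measure)
  qed (use P(3) * in \<open>auto simp: L2_space_def\<close>)
  also have "\<dots> = measure P V / m\<^sup>2"
    using P(2) sets.sets_into_space[OF P(2)] by (simp add: power_divide Int_absorb2)
  finally show ?thesis
    by (simp add: L2_norm_power2)
qed

lemma emeasure_density_le: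
  assumes "f \<in> borel_measurable M" "V \<in> sets M" "\<And>y. y \<in> V \<Longrightarrow> f y \<le> B"
  shows "emeasure (density M f) V \<le> B * emeasure M V"
proof -
  have "emeasure (density M f) V = (\<integral>\<^sup>+ y. f y * indicator V y \<partial>M)"
    using assms by (simp add: emeasure_density)
  also have "\<dots> \<le> (\<integral>\<^sup>+ y. B * indicator V y \<partial>M)"
    using assms by (intro nn_integral_mono) (auto simp: indicator_def)
  finally show ?thesis
    using assms by (simp add: nn_integral_cmult_indicator)
qed

theorem mainTheorem3:
  fixes \<mu> :: "'a::t2_space measure"
    and p0 u :: "'a \<Rightarrow> real"
    and P0 :: "'a measure"
    and x :: 'a
    and C K U :: "'a set"
  assumes "locally_compact_space (euclidean :: 'a topology)"
    and "sets \<mu> = sets borel"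
    and "sigma_finite_measure \<mu>"
    and "locally_finite_measure \<mu>"
    and "outer_regular_on \<mu> {x}"
    and "continuous_on UNIV p0"
    and "\<And>y. 0 \<le> p0 y"
    and "P0 = density \<mu> (\<lambda>y. ennreal (p0 y))"
    and "prob_space P0"
    and "x \<in> supp p0"
    and "compact_nhd x C"
    and "compact_nhd x K"
    and "open U"
    and "C \<subseteq> U" and "U \<subseteq> K" and "K \<subseteq> supp p0"
    and "continuous_on UNIV u"
    and "\<And>y. 0 \<le> u y \<and> u y \<le> 1"
    and "\<And>y. y \<in> C \<Longrightarrow> u y = 1"
    and "\<And>y. y \<notin> U \<Longrightarrow> u y = 0"
  shows "0 < semiparametric_information P0 (cont_fun K) (local_score p0 u K) (local_gradient x)
    \<longleftrightarrow> 0 < emeasure \<mu> {x}"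
proof -
  note sets_\<mu> = assms(2)
  interpret P0: prob_space P0 by (rule assms(9))
  have fin: "finite_measure P0" by unfold_locales
  have sets_P0: "sets P0 = sets borel"
    using assms(2,8) by simp
  have p0_meas: "(\<lambda>y. ennreal (p0 y)) \<in> borel_measurable \<mu>"
    unfolding measurable_cong_sets[OF sets_\<mu> refl]
    using borel_measurable_continuous_onI[OF assms(6)] by measurable
  have x: "x \<in> K" "x \<in> C" "p0 x > 0" "u x = 1" and K: "compact K"
    using assms(10-12,19) interior_subset unfolding compact_nhd_def supp_def by blast+
  \<comment> \<open>The integral of a non-integrable function defaults to 0, so comparing norms
    through monotonicity of the integral requires square integrability of every score.\<close>
  have L2: "local_score p0 u K \<alpha> \<in> L2_space P0" if "\<alpha> \<in> cont_fun K" for \<alpha>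
    unfolding assms(8) using assms that K by (intro local_score_in_L2) auto
  have "(\<lambda>y\<in>K. 1) \<in> cont_fun K" "local_gradient x (\<lambda>y\<in>K. 1) \<noteq> 0"
    using x by (auto simp: cont_fun_def local_gradient_def)
  then have "\<exists>\<alpha>\<in>cont_fun K. local_gradient x \<alpha> \<noteq> 0"
    by blast
  note pos_iff = semiparametric_information_pos_iff[OF this, of P0 "local_score p0 u K"]
  show ?thesis
  proof
    assume atom: "0 < emeasure \<mu> {x}"
    \<comment> \<open>Since \<open>p0 x > 0\<close>, an atom of \<open>\<mu>\<close> at
      \<open>x\<close> is also an atom of \<open>P0\<close>.\<close>
    have "emeasure P0 {x} = ennreal (p0 x) * emeasure \<mu> {x}"
      unfolding assms(8) using p0_meas sets_\<mu> by (simp add: emeasure_density nn_integral_cmult_indicator)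
    then have "emeasure P0 {x} > 0"
      using atom x by (simp add: ennreal_zero_less_mult_iff)
    then have "measure P0 {x} / (p0 x)\<^sup>2 > 0"
      using x by (simp add: P0.emeasure_eq_measure)
    moreover have "measure P0 {x} / (p0 x)\<^sup>2 * (local_gradient x \<alpha>)\<^sup>2
        \<le> (L2_norm P0 (local_score p0 u K \<alpha>))\<^sup>2" if "\<alpha> \<in> cont_fun K" for \<alpha>
      unfolding local_gradient_def
      using fin sets_P0 L2[OF that] x by (intro local_score_norm_ge_atom) auto
    ultimately show "0 < semiparametric_information P0 (cont_fun K) (local_score p0 u K) (local_gradient x)"
      unfolding pos_iff by blast
  next
    assume "0 < semiparametric_information P0 (cont_fun K) (local_score p0 u K) (local_gradient x)"
    then obtain c where c: "c > 0" "\<And>\<alpha>. \<alpha> \<in> cont_fun K \<Longrightarrow>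
        c * (local_gradient x \<alpha>)\<^sup>2 \<le> (L2_norm P0 (local_score p0 u K \<alpha>))\<^sup>2"
      unfolding pos_iff by blast
    \<comment> \<open>Near \<open>x\<close> the density is pinched from both sides: the lower bound
      controls the division by \<open>p0\<close> in the score, the upper bound compares
      \<open>P0\<close> with \<open>\<mu>\<close>.\<close>
    define W where "W = {y. p0 x / 2 < p0 y} \<inter> {y. p0 y < 2 * p0 x}"
    have W: "open W" "x \<in> W"
      unfolding W_def using x assms(6) by (auto intro!: open_Collect_less continuous_intros)
    \<comment> \<open>The value comes from solving \<open>c * (p0 x / 2)^2 = 2 * p0 x * d\<close>,
      where the left side bounds \<open>P0 (V \<inter> W)\<close> from below and
      \<open>2 * p0 x * \<mu> V\<close> bounds it from above.\<close>
    define d where "d = c * p0 x / 8"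
    \<comment> \<open>The uniform bound is tested on a bump function concentrated in
      \<open>V \<inter> W\<close>. The constant \<open>d\<close> is the same for all
      \<open>V\<close>, which lets the bound survive the infimum.\<close>
    have "ennreal d \<le> emeasure \<mu> V" if V: "{x} \<subseteq> V" "open V" for V
    proof -
      let ?V = "V \<inter> W"
      have V': "open ?V" "x \<in> ?V" using V W by auto
      obtain \<alpha> where \<alpha>: "\<alpha> \<in> cont_fun K" "\<alpha> x = 1" "\<And>y. y \<in> K \<Longrightarrow> 0 \<le> \<alpha> y \<and> \<alpha> y \<le> 1"
        "\<And>y. y \<in> K \<Longrightarrow> y \<notin> ?V \<Longrightarrow> \<alpha> y = 0"
        using compact_bump_function[OF K x(1) V'] by blast
      have "c \<le> (L2_norm P0 (local_score p0 u K \<alpha>))\<^sup>2"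
        using c(2)[OF \<alpha>(1)] \<alpha>(2) by (simp add: local_gradient_def)
      also have "\<dots> \<le> measure P0 ?V / (p0 x / 2)\<^sup>2"
        using fin V' sets_P0 L2[OF \<alpha>(1)] x assms(18) \<alpha>
        by (intro local_score_norm_le_support) (auto simp: W_def)
      finally have "c * (p0 x / 2)\<^sup>2 \<le> measure P0 ?V"
        using x by (simp add: field_simps)
      then have "ennreal (c * (p0 x / 2)\<^sup>2) \<le> emeasure P0 ?V"
        by (simp add: P0.emeasure_eq_measure ennreal_leI)
      also have "\<dots> \<le> ennreal (2 * p0 x) * emeasure \<mu> ?V"
        unfolding assms(8) using p0_meas V' sets_\<mu>
        by (intro emeasure_density_le) (auto simp: W_def intro!: ennreal_leI)
      also have "\<dots> \<le> ennreal (2 * p0 x) * emeasure \<mu> V"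
        using V sets_\<mu> by (intro mult_left_mono emeasure_mono) auto
      also have "c * (p0 x / 2)\<^sup>2 = 2 * p0 x * d"
        by (simp add: d_def power2_eq_square)
      finally have "ennreal (2 * p0 x) * ennreal d \<le> ennreal (2 * p0 x) * emeasure \<mu> V"
        using x by (subst ennreal_mult'[symmetric]) simp_all
      \<comment> \<open>The factor \<open>2 * p0 x\<close> is positive and finite, hence cancels in
        the extended nonnegative reals.\<close>
      then show ?thesis
        using x by (simp add: ennreal_mult_le_mult_iff)
    qed
    \<comment> \<open>By outer regularity \<open>\<mu> {x}\<close> is the infimum of
      \<open>\<mu> V\<close> over the open \<open>V\<close> containing \<open>x\<close>, so the
      lower bound \<open>d\<close> passes to the point.\<close>
    then have "ennreal d \<le> emeasure \<mu> {x}"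
      using assms(5) unfolding outer_regular_on_def by (auto intro!: INF_greatest)
    moreover have "0 < d"
      using x c(1) by (simp add: d_def)
    ultimately show "0 < emeasure \<mu> {x}"
      by (metis ennreal_less_zero_iff less_le_trans)
  qed
qed

end
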